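(* Let $\mathcal{X}$ be a finite state space, $\pi$ a probability mass function on $\mathcal{X}$ with full support, $P \in \mathcal{S}(\pi)$, and $Q \in \mathcal{I}(\pi) \cap \mathcal{L}$ an isometric involution transition matrix. Let $\Pi$ be the matrix each of whose rows equals $\pi$, and $\overline{P}(Q):=\frac12(P+QP^*Q)$. If $\overline{P}(Q) = \Pi$, then $$\lambda(P) \cap \lambda(-P^* ) \neq \emptyset,$$ that is, $P$ and $-P^*$ have at least one common eigenvalue.
   Context: $\mathcal{L}$ is the set of transition (row-stochastic) matrices on $\mathcal{X}$; $\mathcal{S}(\pi)\subseteq\mathcal{L}$ is the set of those with $\pi P=\pi$. For a real matrix $M$ on $\mathcal{X}$, $M^*(x,y)=\frac{\pi(y)}{\pi(x)}M(y,x)$ is the $\ell^2(\pi)$-adjoint of $M$. $\mathcal{I}(\pi)$ is the set of isometric involution matrices with respect to $\pi$, i.e. real matrices $Q$ on $\mathcal{X}$ with $Q^2=I$ and $Q^*=Q$. $\lambda(M)$ is the set of (complex) eigenvalues of $M$.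
   Formalization: The state space is assumed to have at least two points; for a one-point space P = Q = Π = [1] satisfies all hypotheses, but λ(P) = {1} and λ(−P* ) = {−1} are disjoint. *)

theory Defs
  imports "HOL-Probability.Probability"
begin

text \<open>
  The state space is a finite type \<open>'x\<close>. A probability mass function on it is an element of
  \<open>'x pmf\<close>, and full support is expressed by \<open>set_pmf \<pi> = UNIV\<close>.
\<close>

definition transition_matrices :: "(real ^ 'x ^ 'x) set" where
  "transition_matrices = {P. (\<forall>x y. 0 \<le> P $ x $ y) \<and> (\<forall>x. (\<Sum>y\<in>UNIV. P $ x $ y) = 1)}"

definition pmf_vec :: "'x pmf \<Rightarrow> real ^ 'x" where
  "pmf_vec \<pi> = (\<chi> x. pmf \<pi> x)"

definition stationary_matrices :: "'x pmf \<Rightarrow> (real ^ 'x ^ 'x) set" where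
  "stationary_matrices \<pi> = {P \<in> transition_matrices. pmf_vec \<pi> v* P = pmf_vec \<pi>}"

text \<open>
  The adjoint in \<open>\<ell>\<^sup>2(\<pi>)\<close>; meaningful when \<open>\<pi>\<close> has full support.
\<close>

definition pi_adjoint :: "'x pmf \<Rightarrow> real ^ 'x ^ 'x \<Rightarrow> real ^ 'x ^ 'x" where
  "pi_adjoint \<pi> M = (\<chi> x y. pmf \<pi> y / pmf \<pi> x * M $ y $ x)"

definition isometric_involutions :: "'x pmf \<Rightarrow> (real ^ 'x ^ 'x) set" where
  "isometric_involutions \<pi> = {Q. Q ** Q = mat 1 \<and> pi_adjoint \<pi> Q = Q}"

definition rank_one_matrix :: "'x pmf \<Rightarrow> real ^ 'x ^ 'x" where
  "rank_one_matrix \<pi> = (\<chi> x. pmf_vec \<pi>)"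

definition P_bar :: "'x pmf \<Rightarrow> real ^ 'x ^ 'x \<Rightarrow> real ^ 'x ^ 'x \<Rightarrow> real ^ 'x ^ 'x" where
  "P_bar \<pi> P Q = (1/2) *\<^sub>R (P + Q ** pi_adjoint \<pi> P ** Q)"

text \<open>
  The complex eigenvalues of a real matrix (acting on column vectors).
\<close>

definition eigenvalues :: "real ^ 'x ^ 'x \<Rightarrow> complex set" where
  "eigenvalues M = {c. \<exists>v. v \<noteq> 0 \<and> map_matrix complex_of_real M *v v = c *s v}"

end

theory Submission
  imports Defs "HOL-Computational_Algebra.Fundamental_Theorem_Algebra"
begin

text \<open>
  The space of vectors \<open>v\<close> with \<open>\<pi> v = 0\<close> is invariant under \<open>P\<close> and is nonzero because there are
  at least two states, so it contains a complex eigenvector \<open>v\<close> of \<open>P\<close>, with eigenvalue \<open>c\<close> say.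
  There \<open>\<Pi>\<close> vanishes, so \<open>P + Q P\<^sup>* Q = 2 \<Pi>\<close> gives \<open>c v = - Q P\<^sup>* Q v\<close>; multiplying by the
  involution \<open>Q\<close> shows that \<open>Q v\<close> is an eigenvector of \<open>- P\<^sup>*\<close> with eigenvalue \<open>c\<close>.
\<close>

text \<open>This is the vector \<open>p(A) u\<close>. Only iterates of \<open>A\<close> on a vector
  occur, so no powers of matrices have to be formed.\<close>

definition mat_poly :: "'a::field ^ 'n ^ 'n \<Rightarrow> 'a poly \<Rightarrow> 'a ^ 'n \<Rightarrow> 'a ^ 'n" where
  "mat_poly A p u = (\<Sum>i\<le>degree p. coeff p i *s ((*v) A ^^ i) u)"

lemma mat_poly_0 [simp]: "mat_poly A 0 u = 0"
  by (simp add: mat_poly_def)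

lemma mat_poly_pCons [simp]: "mat_poly A (pCons a p) u = a *s u + mat_poly A p (A *v u)"
proof (cases "p = 0")
  case False
  then show ?thesis
    by (simp add: mat_poly_def sum.atMost_Suc_shift funpow_swap1 del: sum.atMost_Suc)
qed (simp add: mat_poly_def)

lemma mat_poly_add: "mat_poly A (p + q) u = mat_poly A p u + mat_poly A q u"
  by (induction p q arbitrary: u rule: poly_induct2)
    (simp_all add: vector_sadd_rdistrib)

lemma mat_poly_minus: "mat_poly A (- p) u = - mat_poly A p u"
proof -
  have "mat_poly A (- p) u + mat_poly A p u = 0"
    by (simp flip: mat_poly_add)
  then show ?thesis
    by (simp add: eq_neg_iff_add_eq_0)
qed

lemma mat_poly_smult: "mat_poly A (smult c p) u = c *s mat_poly A p u"
  by (induction p arbitrary: u) (simp_all add: vector_add_ldistrib vector_smult_assoc)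

lemma mat_poly_monom: "mat_poly A (monom c i) u = c *s ((*v) A ^^ i) u"
  by (induction i arbitrary: u) (simp_all add: monom_0 monom_Suc funpow_swap1)

lemma mat_poly_sum: "mat_poly A (\<Sum>i\<in>I. p i) u = (\<Sum>i\<in>I. mat_poly A (p i) u)"
  by (induction I rule: infinite_finite_induct) (simp_all add: mat_poly_add)

lemma mat_poly_vadd: "mat_poly A p (u + v) = mat_poly A p u + mat_poly A p v"
  by (induction p arbitrary: u v)
    (simp_all add: vector_add_ldistrib matrix_vector_right_distrib)

lemma mat_poly_vscale: "mat_poly A p (c *s u) = c *s mat_poly A p u"
  by (induction p arbitrary: u)
    (simp_all add: vector_add_ldistrib vector_smult_assoc mult.commute vector_scalar_commute)

text \<open>Polynomials in \<open>A\<close> commute, so the factor \<open>A - c\<close> may be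
  applied to \<open>u\<close> first. This peels off a root and lowers the degree at the price of
  changing the vector.\<close>

lemma mat_poly_linear_factor:
  "mat_poly A ([:-c, 1:] * q) u = mat_poly A q (A *v u - c *s u)"
proof -
  have "[:-c, 1:] * q = pCons 0 q + - smult c q"
    by simp
  then have "mat_poly A ([:-c, 1:] * q) u = mat_poly A q (A *v u) + mat_poly A q ((-c) *s u)"
    by (simp only: mat_poly_add mat_poly_minus mat_poly_smult mat_poly_vscale mat_poly_pCons) (simp add: vec.scale_minus_left)
  then show ?thesis
    by (simp flip: mat_poly_vadd)
qed

text \<open>The iterates \<open>u\<close>, \<open>A u\<close>, \<open>A (A u)\<close>, ... lie in a
  finite-dimensional space, so they satisfy a nontrivial linear relation, whose coefficients are
  those of \<open>p\<close>.\<close>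

lemma exists_annihilating_poly:
  fixes A :: "'a::field ^ 'n ^ 'n"
  obtains p where "p \<noteq> 0" "mat_poly A p u = 0"
proof -
  define f where "f i = ((*v) A ^^ i) u" for i
  show thesis
  \<comment> \<open>Dependence is a property of the set \<open>range f\<close> and does not see
    repeated iterates, so those form a separate case.\<close>
  proof (cases "inj f")
    case True
    then have "infinite (range f)"
      by (rule range_inj_infinite)
    then have "vec.dependent (range f)"
      using vec.finiteI_independent by blast
    then obtain t c v where t: "finite t" "t \<subseteq> range f" "(\<Sum>w\<in>t. c w *s w) = 0"
      and v: "v \<in> t" "c v \<noteq> 0"
      unfolding vec.dependent_explicit by blast
    from v(1) t(2) obtain j where j: "v = f j"
      by blast
    \<comment> \<open>By injectivity each vector of \<open>t\<close> has exactly one index, so the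
      relation reads as a polynomial whose coefficient at \<open>j\<close> is \<open>c v\<close>,
      which is nonzero.\<close>
    define I where "I = f -` t"
    have I: "finite I" "f ` I = t"
      using t(1,2) True by (auto simp: I_def finite_vimageI)
    define p where "p = (\<Sum>i\<in>I. monom (c (f i)) i)"
    have "mat_poly A p u = (\<Sum>i\<in>I. c (f i) *s f i)"
      by (simp add: p_def mat_poly_sum mat_poly_monom f_def)
    also have "\<dots> = (\<Sum>w\<in>f ` I. c w *s w)"
      using True by (subst sum.reindex) (auto intro: inj_on_subset)
    finally have "mat_poly A p u = 0"
      using t(3) I(2) by simp
    moreover have "coeff p j \<noteq> 0"
      using v j I(1) by (simp add: p_def coeff_sum I_def)
    ultimately show thesis
      using that by (metis coeff_0)
  next
    case False
    then obtain i j where ij: "f i = f j" "i \<noteq> j"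
      by (auto simp: inj_def)
    \<comment> \<open>A repetition \<open>f i = f j\<close> is itself a relation, given by the
      difference of two monomials.\<close>
    have "coeff (monom 1 i + - monom 1 j :: 'a poly) i \<noteq> 0"
      using ij(2) by simp
    then have "monom 1 i + - monom 1 j \<noteq> (0 :: 'a poly)"
      by (metis coeff_0)
    moreover have "mat_poly A (monom 1 i + - monom 1 j) u = 0"
      using ij(1) by (simp only: mat_poly_add mat_poly_minus mat_poly_monom f_def) simp
    ultimately show thesis
      using that by blast
  qed
qed

text \<open>Over the complex numbers an annihilating polynomial of \<open>u\<close> splits. Applying
  its linear factors one by one stays inside \<open>W\<close>, and the last nonzero vector before
  reaching 0 is an eigenvector.\<close>

lemma eigenvector_in_invariant_subspace:
  fixes A :: "complex ^ 'n ^ 'n"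
  assumes W: "vec.subspace W" and inv: "\<And>w. w \<in> W \<Longrightarrow> A *v w \<in> W"
    and u: "u \<in> W" "u \<noteq> 0"
  obtains v c where "v \<in> W" "v \<noteq> 0" "A *v v = c *s v"
proof -
  \<comment> \<open>The vector varies along with the polynomial, since the induction on the degree
    replaces \<open>u\<close> by \<open>A *v u - c *s u\<close>.\<close>
  have "\<exists>v\<in>W. v \<noteq> 0 \<and> (\<exists>c. A *v v = c *s v)"
    if "p \<noteq> 0" "mat_poly A p u = 0" "u \<in> W" "u \<noteq> 0" for p u
    using that
  proof (induction "degree p" arbitrary: p u)
    \<comment> \<open>A nonzero constant cannot annihilate a nonzero vector, so this case is
      contradictory.\<close>
    case 0
    then obtain a where "p = [:a:]"
      by (metis degree_eq_zeroE)
    with 0 show ?case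
      by simp
  next
    case (Suc n)
    then have "\<not> constant (poly p)"
      by (simp add: constant_degree)
    then obtain c where "poly p c = 0"
      using fundamental_theorem_of_algebra by blast
    then obtain q where p: "p = [:-c, 1:] * q"
      by (auto simp: poly_eq_0_iff_dvd dvd_def)
    with Suc.prems(1) have q: "q \<noteq> 0"
      by auto
    have n: "n = degree q"
      using Suc.hyps(2) q unfolding p by (subst (asm) degree_mult_eq) auto
    define w where "w = A *v u - c *s u"
    have w: "w \<in> W"
      unfolding w_def using W inv Suc.prems(3)
      by (intro vec.subspace_diff vec.subspace_scale) auto
    have "mat_poly A q w = 0"
      using Suc.prems(2) unfolding p mat_poly_linear_factor w_def .
    show ?case
    proof (cases "w = 0")
      case True
      then show ?thesis
        using Suc.prems(3,4) by (auto simp: w_def)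
    next
      case False
      show ?thesis
        by (rule Suc.hyps(1)) fact+
    qed
  qed
  then show thesis
    using that exists_annihilating_poly u by metis
qed

lemma map_matrix_of_real_mult:
  "map_matrix complex_of_real (A ** B) = map_matrix complex_of_real A ** map_matrix complex_of_real B"
  by (simp add: matrix_matrix_mult_def vec_eq_iff)

lemma map_matrix_of_real_mat_1: "map_matrix complex_of_real (mat 1) = mat 1"
  by (simp add: mat_def vec_eq_iff)

lemma rank_one_matrix_mult_vec:
  "(map_matrix complex_of_real (rank_one_matrix \<pi>) *v v) $ x = (\<Sum>y\<in>UNIV. of_real (pmf \<pi> y) * v $ y)"
  by (simp add: matrix_vector_mult_def rank_one_matrix_def pmf_vec_def)

theorem corollary5p2:
  fixes \<pi> :: "'x::finite pmf"
    and P Q :: "real ^ 'x ^ 'x"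
  assumes "CARD('x) \<ge> 2"
    and "set_pmf \<pi> = UNIV"
    and "P \<in> stationary_matrices \<pi>"
    and "Q \<in> isometric_involutions \<pi> \<inter> transition_matrices"
    and "P_bar \<pi> P Q = rank_one_matrix \<pi>"
  shows "eigenvalues P \<inter> eigenvalues (- pi_adjoint \<pi> P) \<noteq> {}"
proof -
  define W :: "(complex ^ 'x) set" where
    "W = {v. (\<Sum>y\<in>UNIV. of_real (pmf \<pi> y) * v $ y) = 0}"
  \<comment> \<open>Matrices are complexified because the eigenvector comes from splitting a
    polynomial.\<close>
  define C where "C = (map_matrix complex_of_real :: real ^ 'x ^ 'x \<Rightarrow> _)"
  have W: "vec.subspace W"
    by (auto simp: W_def vec.subspace_def distrib_left sum.distrib mult.left_commute
        simp flip: sum_distrib_left)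
  have stat: "(\<Sum>x\<in>UNIV. pmf \<pi> x * P $ x $ y) = pmf \<pi> y" for y
    using assms(3)
    by (simp add: stationary_matrices_def pmf_vec_def vector_matrix_mult_def vec_eq_iff mult.commute)
  have inv: "C P *v w \<in> W" if "w \<in> W" for w
  proof -
    have "(\<Sum>x\<in>UNIV. of_real (pmf \<pi> x) * (C P *v w) $ x)
        = (\<Sum>x\<in>UNIV. \<Sum>y\<in>UNIV. of_real (pmf \<pi> x * P $ x $ y) * w $ y)"
      by (simp add: C_def matrix_vector_mult_def sum_distrib_left mult.assoc)
    \<comment> \<open>Swapping the sums moves \<open>P\<close> onto \<open>\<pi>\<close>, where
      stationarity absorbs it.\<close>
    also have "\<dots> = (\<Sum>y\<in>UNIV. of_real (\<Sum>x\<in>UNIV. pmf \<pi> x * P $ x $ y) * w $ y)"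
      by (subst sum.swap) (simp add: sum_distrib_right)
    also have "\<dots> = 0"
      using that unfolding stat W_def by simp
    finally show ?thesis
      by (simp add: W_def)
  qed
  obtain a b :: 'x where ab: "a \<noteq> b"
    using assms(1) by (metis UNIV_I card_2_iff' card_le_Suc0_iff_eq finite not_less_eq_eq
        numeral_2_eq_2)
  \<comment> \<open>The crossed weights make the two contributions to the \<open>\<pi>\<close>-mean
    cancel; full support makes the entry at \<open>a\<close> nonzero.\<close>
  define u :: "complex ^ 'x" where
    "u = axis a (of_real (pmf \<pi> b)) - axis b (of_real (pmf \<pi> a))"
  have "u $ a \<noteq> 0"
    using ab assms(2) by (simp add: u_def axis_def pmf_eq_0_set_pmf)
  then have u0: "u \<noteq> 0"
    by auto
  have "(\<Sum>y\<in>UNIV. f y * axis i k $ y) = f i * k" for f :: "'x \<Rightarrow> complex" and i k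
    by (simp add: axis_def if_distrib cong: if_cong)
  then have uW: "u \<in> W"
    by (simp add: W_def u_def right_diff_distrib sum_subtractf)
  obtain v c where v: "v \<in> W" "v \<noteq> 0" "C P *v v = c *s v"
    using eigenvector_in_invariant_subspace[OF W inv uW u0] by blast
  have "P + Q ** pi_adjoint \<pi> P ** Q = 2 *\<^sub>R rank_one_matrix \<pi>"
    by (simp add: P_bar_def flip: assms(5))
  then have "Q ** pi_adjoint \<pi> P ** Q = 2 *\<^sub>R rank_one_matrix \<pi> - P"
    by (simp add: algebra_simps)
  then have "C (Q ** pi_adjoint \<pi> P ** Q) *v v = C (2 *\<^sub>R rank_one_matrix \<pi> - P) *v v"
    by simp
  also have "\<dots> = 2 *s (C (rank_one_matrix \<pi>) *v v) - C P *v v"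
    by (simp add: C_def vec_eq_iff matrix_vector_mult_def sum_distrib_left algebra_simps
        sum_subtractf)
  also have "C (rank_one_matrix \<pi>) *v v = 0"
    using v(1) by (simp add: vec_eq_iff C_def rank_one_matrix_mult_vec W_def)
  finally have key: "C Q *v (C (pi_adjoint \<pi> P) *v (C Q *v v)) = - (c *s v)"
    by (simp add: v(3)[unfolded C_def] C_def map_matrix_of_real_mult matrix_vector_mul_assoc
        matrix_mul_assoc)
  have QQ: "C Q *v (C Q *v w) = w" for w
    using assms(4)
    by (simp add: isometric_involutions_def matrix_vector_mul_assoc C_def
        map_matrix_of_real_mat_1 flip: map_matrix_of_real_mult)
  \<comment> \<open>Applying \<open>C Q\<close> to both sides of \<open>key\<close> cancels the
    outer factor by \<open>QQ\<close>.\<close>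
  have "C (pi_adjoint \<pi> P) *v (C Q *v v) = C Q *v (- (c *s v))"
    by (metis key QQ)
  also have "\<dots> = - (c *s (C Q *v v))"
    by (simp add: vec_eq_iff matrix_vector_mult_def sum_distrib_left sum_negf algebra_simps)
  finally have "C (- pi_adjoint \<pi> P) *v (C Q *v v) = c *s (C Q *v v)"
    by (simp add: C_def vec_eq_iff matrix_vector_mult_def sum_negf)
  moreover have "C Q *v v \<noteq> 0"
    using QQ[of v] v(2) by auto
  ultimately have "c \<in> eigenvalues (- pi_adjoint \<pi> P)"
    by (auto simp: eigenvalues_def C_def)
  moreover have "c \<in> eigenvalues P"
    using v(2,3) by (auto simp: eigenvalues_def C_def)
  ultimately show ?thesis
    by blast
qed

end
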